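(* Let $G$ be a finite connected graph of order at least $4$. Then $$\operatorname{sdiam}_4(G)\leq \frac{10}{7}\,\operatorname{srad}_4(G).$$
   Context: Graphs are finite, simple and undirected. The order of a graph is its number of vertices, and its size is its number of edges. For a connected graph $G$ and a non-empty set $S\subseteq V(G)$, the Steiner distance $d(S)$ is the minimum size (number of edges) of a connected subgraph of $G$ containing all vertices of $S$. For an integer $k$ with $2\le k\le |V(G)|$ and $v\in V(G)$, the Steiner $k$-eccentricity of $v$ is $\operatorname{e}_k(v)=\max\{d(S): S\subseteq V(G),\ |S|=k,\ v\in S\}$. The Steiner $k$-radius is $\operatorname{srad}_k(G)=\min\{\operatorname{e}_k(v):v\in V(G)\}$ and the Steiner $k$-diameter is $\operatorname{sdiam}_k(G)=\max\{\operatorname{e}_k(v):v\in V(G)\}$. *)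

theory Defs
  imports Complex_Main "Graph_Theory.Digraph_Component"
begin

text \<open>
  A finite simple undirected graph is a \<^locale>\<open>pair_graph\<close>: every undirected edge is represented
  by its two opposite arcs, so the edges are counted as unordered pairs of end vertices.
  \<^const>\<open>Digraph_Component.connected\<close> is written with its qualifier because Complex_Main has a
  topological constant of the same base name.
\<close>

definition edges :: "'a pair_pre_digraph \<Rightarrow> 'a set set" where
  "edges G = {{u, v} | u v. (u, v) \<in> parcs G}"

definition steiner_distance :: "'a pair_pre_digraph \<Rightarrow> 'a set \<Rightarrow> nat" where
  "steiner_distance G S =
     (LEAST n. \<exists>H :: 'a pair_pre_digraph. pair_graph H \<and> subgraph (with_proj H) (with_proj G) \<and>
        Digraph_Component.connected (with_proj H) \<and> S \<subseteq> pverts H \<and> card (edges H) = n)"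

definition steiner_ecc :: "nat \<Rightarrow> 'a pair_pre_digraph \<Rightarrow> 'a \<Rightarrow> nat" where
  "steiner_ecc k G v =
     Max {steiner_distance G S | S. S \<subseteq> pverts G \<and> card S = k \<and> v \<in> S}"

definition srad :: "nat \<Rightarrow> 'a pair_pre_digraph \<Rightarrow> nat" where
  "srad k G = Min {steiner_ecc k G v | v. v \<in> pverts G}"

definition sdiam :: "nat \<Rightarrow> 'a pair_pre_digraph \<Rightarrow> nat" where
  "sdiam k G = Max {steiner_ecc k G v | v. v \<in> pverts G}"

end

(* Let D be a 4-set with d(D) = sdiam_4(G), let w be a central vertex and r = srad_4(G). For every i
   in D some tree of size at most r contains w and D - {i}. Suppressing vertices of degree 2, this
   tree has one inner edge, which separates {w, p(i)} from the other two vertices of D. A fixed-point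
   free map p on a 4-set has arguments i \<noteq> k with p(i) = p(k), or with {i, p(i)} and {k, p(k)} disjoint.
   In either case the trees for i and k can be cut and recombined into trees that contain D; a
   nonnegative combination of their sizes, found by linear programming, gives 7 d(D) \<le> 10 r. *)

theory Submission
  imports Defs
begin

section \<open>Connected subgraphs grown edge by edge\<close>

(* v may already lie in S, so n only bounds the number of edges from above. *)
inductive grown :: "'a pair_pre_digraph \<Rightarrow> nat \<Rightarrow> 'a set \<Rightarrow> bool" for G where
  single: "r \<in> pverts G \<Longrightarrow> grown G 0 {r}"
| step: "\<lbrakk>grown G n S; u \<in> S; (u, v) \<in> parcs G\<rbrakk> \<Longrightarrow> grown G (Suc n) (insert v S)"

text \<open>The slack in both the edge count and the vertex set makes this notion monotone. In a
  connected graph it says that the Steiner distance of \<open>S\<close> is at most \<open>n\<close>,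
  without fixing an optimal tree.\<close>

definition spans :: "'a pair_pre_digraph \<Rightarrow> nat \<Rightarrow> 'a set \<Rightarrow> bool" where
  "spans G n S \<longleftrightarrow> (\<exists>m T. m \<le> n \<and> S \<subseteq> T \<and> grown G m T)"

text \<open>Arcs come in opposite pairs, so the symmetric closure adds nothing, and they end inside
  the vertex set, so walks cannot leave it. Connectivity thus becomes accessible to plain induction
  on \<open>rtrancl\<close>.\<close>

lemma connected_pair_graph_iff:
  assumes "pair_graph H"
  shows "Digraph_Component.connected (with_proj H) \<longleftrightarrow>
    pverts H \<noteq> {} \<and> (\<forall>u\<in>pverts H. \<forall>v\<in>pverts H. (u, v) \<in> (parcs H)\<^sup>*)"
proof -
  interpret pair_graph H by fact
  have "symcl (parcs H) = parcs H"
    using arcs_symmetric by (auto simp: symcl_def)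
  moreover have "(u, v) \<in> rtrancl_on (pverts H) (parcs H) \<longleftrightarrow> (u, v) \<in> (parcs H)\<^sup>*"
    if "u \<in> pverts H" for u v
  proof
    assume "(u, v) \<in> (parcs H)\<^sup>*"
    then show "(u, v) \<in> rtrancl_on (pverts H) (parcs H)"
      by induction (use that in \<open>auto intro: rtrancl_on_into_rtrancl_on dest: in_arcsD2\<close>)
  qed (rule rtrancl_on_rtranclI)
  ultimately show ?thesis
    unfolding connected_conv with_proj_simps by simp
qed

lemma finite_edges:
  assumes "pair_graph G"
  shows "finite (edges G)"
proof -
  interpret pair_graph G by fact
  have "edges G = (\<lambda>(u, v). {u, v}) ` parcs G"
    by (auto simp: edges_def)
  then show ?thesis
    using pair_finite_arcs by simp
qed

lemma grown_mono:
  assumes "grown H n S" "pverts H \<subseteq> pverts G" "parcs H \<subseteq> parcs G"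
  shows "grown G n S"
  using assms by induction (auto intro: grown.intros)

lemma grown_subset:
  assumes "pair_graph G" "grown G n S"
  shows "S \<subseteq> pverts G"
proof -
  interpret pair_graph G by fact
  show ?thesis
    using assms(2) by induction (auto dest: in_arcsD2)
qed

lemma grown_finite:
  assumes "grown G n S"
  shows "finite S"
  using assms by induction auto

text \<open>The growth of \<open>T\<close> is replayed on top of \<open>S\<close>. Both
  \<open>S\<close> and the common vertex stay arbitrary in the induction, since \<open>S\<close> may
  have to be enlarged first.\<close>

lemma grown_Un:
  assumes "pair_graph G" "grown G n T" "grown G m S" "x \<in> S" "x \<in> T"
  shows "grown G (m + n) (S \<union> T)"
proof -
  interpret pair_graph G by fact
  show ?thesis
    using assms(2-)
  proof (induction arbitrary: m S x)
    case (single r)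
    then show ?case by (simp add: insert_absorb)
  next
    case (step n T u v)
    show ?case
    proof (cases "x \<in> T")
      case True
      then have "grown G (m + n) (S \<union> T)"
        using step by blast
      then show ?thesis
        using grown.step[of G "m + n" "S \<union> T" u v] step by simp
    next
      case False
      then have "x = v"
        using step by simp
      \<comment> \<open>The common vertex is the one added last to \<open>T\<close>. Its edge is
        walked backwards from \<open>S\<close>, which makes \<open>u\<close> common to both sets;
        the edge moves from one count to the other and the total stays the same.\<close>
      then have "grown G (Suc m) (insert u S)"
        using step grown.step arcs_symmetric by metis
      then have "grown G (Suc m + n) (insert u S \<union> T)"
        using step by blast
      moreover have "insert u S \<union> T = S \<union> insert v T"
        using step \<open>x = v\<close> by auto
      ultimately show ?thesis by simp
    qed
  qed
qed

lemma grown_imp_connected_subgraph: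
  assumes "pair_graph G" "grown G n S"
  shows "\<exists>H. pair_graph H \<and> subgraph (with_proj H) (with_proj G) \<and>
    Digraph_Component.connected (with_proj H) \<and> pverts H = S \<and> card (edges H) \<le> n"
proof -
  interpret G: pair_graph G by fact
  have wfG: "wf_digraph (with_proj G)" ..
  show ?thesis
    using assms(2)
  proof induction
    case (single r)
    let ?H = "\<lparr>pverts = {r}, parcs = {}\<rparr>"
    have H: "pair_graph ?H"
      by unfold_locales (auto simp: symmetric_def sym_def)
    then interpret H: pair_graph ?H .
    have "subgraph (with_proj ?H) (with_proj G)"
      by (intro subgraphI) (use single H.wf_digraph_axioms wfG in auto)
    moreover have "card (edges ?H) \<le> 0"
      by (simp add: edges_def)
    moreover have "Digraph_Component.connected (with_proj ?H)"
      using H by (simp add: connected_pair_graph_iff)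
    ultimately show ?case
      using H by (metis pair_pre_digraph.select_convs(1))
  next
    case (step n S u v)
    then obtain H where H: "pair_graph H" "subgraph (with_proj H) (with_proj G)"
      "Digraph_Component.connected (with_proj H)" "pverts H = S" "card (edges H) \<le> n"
      by blast
    interpret H: pair_graph H by fact
    let ?K = "\<lparr>pverts = insert v S, parcs = parcs H \<union> {(u, v), (v, u)}\<rparr>"
    have "u \<noteq> v"
      using step G.no_loops' by blast
    then have K: "pair_graph ?K"
      using H(4) step(2) H.pair_finite_verts H.pair_finite_arcs H.arcs_symmetric
        H.no_loops' H.in_arcsD1 H.in_arcsD2
      by unfold_locales (auto simp: symmetric_def sym_def)
    then interpret K: pair_graph ?K .
    have "v \<in> pverts G" "(v, u) \<in> parcs G"
      using step G.in_arcsD2 G.arcs_symmetric by blast+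
    moreover have "pverts H \<subseteq> pverts G" "parcs H \<subseteq> parcs G"
      using H(2) by (auto simp: subgraph_def)
    ultimately have "subgraph (with_proj ?K) (with_proj G)"
      using H(4) step(3) by (intro subgraphI) (use K.wf_digraph_axioms wfG in auto)
    moreover have "edges ?K = insert {u, v} (edges H)"
      by (auto simp: edges_def)
    \<comment> \<open>The edge may already belong to \<open>H\<close>, hence only an
      inequality.\<close>
    then have "card (edges ?K) \<le> Suc n"
      using H(5) card_insert_le_m1 card_insert_if finite_edges[OF H(1)] by (metis Suc_le_mono le_SucI)
    moreover have "Digraph_Component.connected (with_proj ?K)"
    proof -
      have old: "(x, y) \<in> (parcs ?K)\<^sup>*" if "x \<in> S" "y \<in> S" for x y
      proof -
        have "(x, y) \<in> (parcs H)\<^sup>*"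
          using H that connected_pair_graph_iff by blast
        then show ?thesis
          by (rule subsetD[OF rtrancl_mono, rotated]) auto
      qed
      have "(u, v) \<in> (parcs ?K)\<^sup>*" "(v, u) \<in> (parcs ?K)\<^sup>*"
        by auto
      then have "(x, y) \<in> (parcs ?K)\<^sup>*" if "x \<in> insert v S" "y \<in> insert v S" for x y
        using that old step(2) by (metis insertE rtrancl.rtrancl_refl rtrancl_trans)
      then show ?thesis
        unfolding connected_pair_graph_iff[OF K] by simp
    qed
    ultimately show ?case
      using K by (metis pair_pre_digraph.select_convs(1))
  qed
qed

text \<open>A largest vertex set that can be grown within its own edge budget must be everything:
  otherwise a walk to a vertex outside crosses its boundary, and the crossing edge enlarges
  it.\<close>

lemma connected_imp_grown:
  assumes "pair_graph H" "Digraph_Component.connected (with_proj H)"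
  shows "\<exists>n\<le>card (edges H). grown H n (pverts H)"
proof -
  interpret pair_graph H by fact
  \<comment> \<open>The budget of \<open>A\<close> is the number of edges with both ends in
    \<open>A\<close>, so that enlarging \<open>A\<close> also enlarges the budget.\<close>
  define P where "P A \<longleftrightarrow> (\<exists>n\<le>card {e \<in> edges H. e \<subseteq> A}. grown H n A)" for A
  obtain r where "r \<in> pverts H"
    using assms connected_pair_graph_iff by blast
  then have "P {r}"
    unfolding P_def by (intro exI[of _ 0]) (auto intro: grown.single)
  moreover have "card A < Suc (card (pverts H))" if "P A" for A
    using that grown_subset[OF assms(1)] card_mono[OF pair_finite_verts]
    by (auto simp: P_def less_Suc_eq_le)
  ultimately obtain A where A: "P A" "\<And>B. P B \<Longrightarrow> card B \<le> card A"
    using ex_has_greatest_nat[of P "{r}" card "Suc (card (pverts H))"] by blast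
  then obtain n where n: "n \<le> card {e \<in> edges H. e \<subseteq> A}" "grown H n A"
    by (auto simp: P_def)
  have AH: "A \<subseteq> pverts H"
    using n grown_subset assms(1) by blast
  have "A = pverts H"
  proof (rule ccontr)
    assume "A \<noteq> pverts H"
    then obtain z where z: "z \<in> pverts H" "z \<notin> A"
      using AH by blast
    obtain a where a: "a \<in> A"
      using n(2) by cases auto
    have "(a, z) \<in> (parcs H)\<^sup>*"
      using assms connected_pair_graph_iff a z AH by blast
    then have "z \<in> A \<or> (\<exists>u v. u \<in> A \<and> v \<notin> A \<and> (u, v) \<in> parcs H)"
      by induction (use a in auto)
    then obtain u v where uv: "u \<in> A" "v \<notin> A" "(u, v) \<in> parcs H"
      using z by blast
    have fin: "finite {e \<in> edges H. e \<subseteq> insert v A}"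
      using finite_edges[OF assms(1)] by simp
    \<comment> \<open>The crossing edge is not inside \<open>A\<close> but is inside
      \<open>insert v A\<close>; it pays for the new step.\<close>
    have "insert {u, v} {e \<in> edges H. e \<subseteq> A} \<subseteq> {e \<in> edges H. e \<subseteq> insert v A}"
      using uv by (auto simp: edges_def)
    then have "card (insert {u, v} {e \<in> edges H. e \<subseteq> A}) \<le> card {e \<in> edges H. e \<subseteq> insert v A}"
      using fin by (rule card_mono[rotated])
    moreover have "card (insert {u, v} {e \<in> edges H. e \<subseteq> A}) = Suc (card {e \<in> edges H. e \<subseteq> A})"
      using uv finite_edges[OF assms(1)] by (intro card_insert_disjoint) auto
    ultimately have "P (insert v A)"
      unfolding P_def using n uv grown.step[of H n A u v] by (intro exI[of _ "Suc n"]) auto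
    then have "card (insert v A) \<le> card A"
      by (rule A(2))
    then show False
      using uv(2) grown_finite[OF n(2)] by simp
  qed
  moreover have "card {e \<in> edges H. e \<subseteq> A} \<le> card (edges H)"
    using finite_edges[OF assms(1)] by (auto intro: card_mono)
  ultimately show ?thesis
    using n le_trans by blast
qed

section \<open>Steiner distance expressed through \<open>spans\<close>\<close>

lemma steiner_distance_le:
  assumes "pair_graph G" "spans G n S"
  shows "steiner_distance G S \<le> n"
proof -
  obtain m T where m: "m \<le> n" "S \<subseteq> T" "grown G m T"
    using assms(2) by (auto simp: spans_def)
  obtain H where H: "pair_graph H" "subgraph (with_proj H) (with_proj G)"
    "Digraph_Component.connected (with_proj H)" "pverts H = T" "card (edges H) \<le> m"
    using grown_imp_connected_subgraph[OF assms(1) m(3)] by blast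
  have "steiner_distance G S \<le> card (edges H)"
    unfolding steiner_distance_def by (rule Least_le) (use H m in auto)
  then show ?thesis
    using H m by simp
qed

lemma spans_steiner_distance:
  assumes "pair_graph G" "Digraph_Component.connected (with_proj G)" "S \<subseteq> pverts G"
  shows "spans G (steiner_distance G S) S"
proof -
  interpret pair_graph G by fact
  let ?Q = "\<lambda>n. \<exists>H :: 'a pair_pre_digraph. pair_graph H \<and> subgraph (with_proj H) (with_proj G) \<and>
    Digraph_Component.connected (with_proj H) \<and> S \<subseteq> pverts H \<and> card (edges H) = n"
  \<comment> \<open>\<open>G\<close> itself is a candidate, so the \<open>LEAST\<close> in the
    definition is attained.\<close>
  have "?Q (card (edges G))"
    using assms subgraph_refl by blast
  then have "?Q (steiner_distance G S)"
    unfolding steiner_distance_def by (rule LeastI)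
  then obtain H where H: "pair_graph H" "subgraph (with_proj H) (with_proj G)"
    "Digraph_Component.connected (with_proj H)" "S \<subseteq> pverts H"
    "card (edges H) = steiner_distance G S"
    by blast
  obtain n where "n \<le> card (edges H)" "grown H n (pverts H)"
    using connected_imp_grown[OF H(1,3)] by blast
  moreover have "pverts H \<subseteq> pverts G" "parcs H \<subseteq> parcs G"
    using H(2) by (auto elim!: subgraphE)
  ultimately show ?thesis
    unfolding spans_def using H(4,5) grown_mono by metis
qed

lemma spans_mono: "\<lbrakk>spans G n S; T \<subseteq> S; n \<le> m\<rbrakk> \<Longrightarrow> spans G m T"
  unfolding spans_def by (meson order_trans)

lemma spans_Un:
  assumes "pair_graph G" "spans G m S" "spans G n T" "S \<inter> T \<noteq> {}"
  shows "spans G (m + n) (S \<union> T)"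
proof -
  obtain m' S' n' T' where "m' \<le> m" "S \<subseteq> S'" "grown G m' S'" "n' \<le> n" "T \<subseteq> T'" "grown G n' T'"
    using assms(2,3) by (auto simp: spans_def)
  moreover from this have "grown G (m' + n') (S' \<union> T')"
    using grown_Un[OF assms(1)] assms(4) by blast
  ultimately show ?thesis
    unfolding spans_def by (intro exI[of _ "m' + n'"] exI[of _ "S' \<union> T'"]) auto
qed

section \<open>The shape of a tree with four terminals\<close>

text \<open>A tree with three terminals, cut at its branch vertex \<open>x\<close> into three legs.
  Legs may overlap or be empty, and terminals may coincide, so paths and single vertices are
  included.\<close>

definition tripod :: "'a pair_pre_digraph \<Rightarrow> nat \<Rightarrow> 'a \<Rightarrow> 'a \<Rightarrow> 'a \<Rightarrow> bool" where
  "tripod G n p q s \<longleftrightarrow> (\<exists>x a b c. spans G a {p, x} \<and> spans G b {q, x} \<and> spans G c {s, x} \<and>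
     a + b + c \<le> n)"

text \<open>A tree with four terminals and inner edge from \<open>x\<close> to \<open>y\<close>, as
  in the quartet topologies of phylogenetics. The argument order records the split: \<open>w\<close>
  and \<open>p\<close> hang on one end, \<open>q\<close> and \<open>s\<close> on the other.\<close>

definition quartet :: "'a pair_pre_digraph \<Rightarrow> nat \<Rightarrow> 'a \<Rightarrow> 'a \<Rightarrow> 'a \<Rightarrow> 'a \<Rightarrow> bool" where
  "quartet G n w p q s \<longleftrightarrow> (\<exists>x y a b c d e.
     spans G a {w, x} \<and> spans G b {p, x} \<and> spans G c {x, y} \<and> spans G d {q, y} \<and> spans G e {s, y} \<and>
     a + b + c + d + e \<le> n)"

lemma tripodI:
  "\<lbrakk>spans G a {p, x}; spans G b {q, x}; spans G c {s, x}; a + b + c \<le> n\<rbrakk> \<Longrightarrow> tripod G n p q s"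
  unfolding tripod_def by (intro exI conjI)

lemma tripodE:
  assumes "tripod G n p q s"
  obtains x a b c where "spans G a {p, x}" "spans G b {q, x}" "spans G c {s, x}" "a + b + c \<le> n"
  using assms unfolding tripod_def by (elim exE conjE) (rule that)

lemma quartetI:
  "\<lbrakk>spans G a {w, x}; spans G b {p, x}; spans G c {x, y}; spans G d {q, y}; spans G e {s, y};
    a + b + c + d + e \<le> n\<rbrakk> \<Longrightarrow> quartet G n w p q s"
  unfolding quartet_def by (intro exI conjI)

lemma quartetE:
  assumes "quartet G n w p q s"
  obtains x y a b c d e where "spans G a {w, x}" "spans G b {p, x}" "spans G c {x, y}"
    "spans G d {q, y}" "spans G e {s, y}" "a + b + c + d + e \<le> n"
  using assms unfolding quartet_def by (elim exE conjE) (rule that)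

lemma spans_refl: "v \<in> pverts G \<Longrightarrow> spans G 0 {v, v}"
  unfolding spans_def by (auto intro: grown.single)

lemma spans_edge:
  assumes "pair_graph G" "spans G n {u, x}" "(u, v) \<in> parcs G"
  shows "spans G (Suc n) {v, x}"
proof -
  obtain m T where "m \<le> n" "{u, x} \<subseteq> T" "grown G m T"
    using assms(2) by (auto simp: spans_def)
  then show ?thesis
    unfolding spans_def using grown.step[of G m T u v] assms(3)
    by (intro exI[of _ "Suc m"] exI[of _ "insert v T"]) auto
qed

lemma tripod_mono: "tripod G n p q s \<Longrightarrow> n \<le> m \<Longrightarrow> tripod G m p q s"
  by (elim tripodE, rule tripodI) (assumption+, erule (1) order_trans)

lemma tripod_rotate: "tripod G n p q s \<Longrightarrow> tripod G n q s p"
  by (elim tripodE, rule tripodI) (assumption+, simp)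

lemma tripod_edge:
  assumes "pair_graph G" "tripod G n u q s" "(u, v) \<in> parcs G"
  shows "tripod G (Suc n) v q s"
proof -
  obtain x a b c where *: "spans G a {u, x}" "spans G b {q, x}" "spans G c {s, x}" "a + b + c \<le> n"
    using assms(2) by (rule tripodE)
  show ?thesis
    by (rule tripodI[OF spans_edge[OF assms(1) *(1) assms(3)] *(2,3)]) (use *(4) in simp)
qed

lemma tripod_degenerate:
  assumes "spans G n {p, q}" "p \<in> pverts G"
  shows "tripod G n p p q"
proof -
  have "spans G n {q, p}"
    using assms(1) by (simp add: insert_commute)
  then show ?thesis
    by (rule tripodI[OF spans_refl[OF assms(2)] spans_refl[OF assms(2)]]) simp
qed

text \<open>Induction on the growth: a terminal at the new vertex \<open>v\<close> has its leg
  prolonged by the edge from \<open>u\<close>. Terminals must be allowed to coincide, because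
  \<open>u\<close> may already be another terminal.\<close>

lemma grown_tripod:
  assumes G: "pair_graph G" and "grown G n S" "p \<in> S" "q \<in> S" "s \<in> S"
  shows "tripod G n p q s"
  using assms(2-)
proof (induction arbitrary: p q s)
  case (single r)
  then have "tripod G 0 r r r"
    by (blast intro: tripod_degenerate spans_refl)
  then show ?case
    using single by simp
next
  case (step n S u v)
  have new: "grown G (Suc n) (insert v S)"
    using step by (blast intro: grown.step)
  then have "v \<in> pverts G"
    using grown_subset[OF G] by blast
  \<comment> \<open>If two terminals sit at \<open>v\<close>, the branch vertex is put there and two
    legs are empty.\<close>
  have dbl: "tripod G (Suc n) v v q" if "q \<in> insert v S" for q
  proof (rule tripod_degenerate)
    show "spans G (Suc n) {v, q}"
      unfolding spans_def using that new by blast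
  qed fact
  have leaf: "tripod G (Suc n) v q s" if mem: "q \<in> insert v S" "s \<in> insert v S" for q s
  proof -
    consider "q = v" | "s = v" | "q \<in> S" "s \<in> S"
      using mem by blast
    then show ?thesis
    proof cases
      case 1
      then show ?thesis using dbl mem by simp
    next
      case 2
      then show ?thesis using dbl[OF mem(1)] tripod_rotate by metis
    next
      case 3
      then show ?thesis using tripod_edge[OF G] step by blast
    qed
  qed
  consider "p = v" | "q = v" | "s = v" | "p \<in> S" "q \<in> S" "s \<in> S"
    using step.prems by blast
  then show ?case
  proof cases
    case 1
    then show ?thesis using leaf step.prems by simp
  next
    case 2
    then show ?thesis using leaf[OF step.prems(3,1)] tripod_rotate by metis
  next
    case 3
    then show ?thesis using leaf[OF step.prems(1,2)] tripod_rotate by metis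
  next
    case 4
    then show ?thesis using tripod_mono[OF step.IH, of p q s "Suc n"] by simp
  qed
qed

lemma quartet_mono: "quartet G n w p q s \<Longrightarrow> n \<le> m \<Longrightarrow> quartet G m w p q s"
  by (elim quartetE, rule quartetI) (assumption+, erule (1) order_trans)

lemma quartet_swap: "quartet G n w p q s \<Longrightarrow> quartet G n w p s q"
  by (elim quartetE, rule quartetI) (assumption+, simp)

lemma quartet_swap': "quartet G n w p q s \<Longrightarrow> quartet G n p w q s"
  by (elim quartetE, rule quartetI) (assumption+, simp)

lemma quartet_flip:
  assumes "quartet G n w p q s"
  shows "quartet G n q s w p"
proof -
  obtain x y a b c d e where *: "spans G a {w, x}" "spans G b {p, x}" "spans G c {x, y}"
    "spans G d {q, y}" "spans G e {s, y}" "a + b + c + d + e \<le> n"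
    using assms by (rule quartetE)
  have "spans G c {y, x}"
    using *(3) by (simp add: insert_commute)
  from *(4,5) this *(1,2) show ?thesis
    by (rule quartetI) (use *(6) in simp)
qed

lemma quartet_edge:
  assumes "pair_graph G" "quartet G n u p q s" "(u, v) \<in> parcs G"
  shows "quartet G (Suc n) v p q s"
proof -
  obtain x y a b c d e where *: "spans G a {u, x}" "spans G b {p, x}" "spans G c {x, y}"
    "spans G d {q, y}" "spans G e {s, y}" "a + b + c + d + e \<le> n"
    using assms(2) by (rule quartetE)
  show ?thesis
    by (rule quartetI[OF spans_edge[OF assms(1) *(1) assms(3)] *(2-5)]) (use *(6) in simp)
qed

lemma quartet_degenerate:
  assumes "tripod G n p q s" "p \<in> pverts G"
  shows "quartet G n p p q s"
proof -
  obtain y c d e where *: "spans G c {p, y}" "spans G d {q, y}" "spans G e {s, y}" "c + d + e \<le> n"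
    using assms(1) by (rule tripodE)
  show ?thesis
    by (rule quartetI[OF spans_refl spans_refl *(1-3)]) (use assms(2) *(4) in auto)
qed

text \<open>Four terminals split into two pairs in three ways, one for each partner of
  \<open>w\<close>.\<close>

definition some_quartet :: "'a pair_pre_digraph \<Rightarrow> nat \<Rightarrow> 'a \<Rightarrow> 'a \<Rightarrow> 'a \<Rightarrow> 'a \<Rightarrow> bool" where
  "some_quartet G n w p q s \<longleftrightarrow> quartet G n w p q s \<or> quartet G n w q p s \<or> quartet G n w s p q"

text \<open>Together with \<open>some_quartet_rotate\<close> this generates all permutations of the
  terminals, so a terminal at a new vertex can be moved to the first place.\<close>

lemma some_quartet_swap: "some_quartet G n w p q s \<Longrightarrow> some_quartet G n p w q s"
  unfolding some_quartet_def 
  using quartet_swap'[of G n w p q s] quartet_flip[of G n w q p s] quartet_flip[of G n w s p q] by blast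

lemma some_quartet_rotate: "some_quartet G n w p q s \<Longrightarrow> some_quartet G n w q s p"
  unfolding some_quartet_def 
  using quartet_swap[of G n w q p s] quartet_swap[of G n w s p q] by blast

lemma some_quartet_mono: "some_quartet G n w p q s \<Longrightarrow> n \<le> m \<Longrightarrow> some_quartet G m w p q s"
  unfolding some_quartet_def by (elim disjE) (simp_all add: quartet_mono)

text \<open>The induction of \<open>grown_tripod\<close> with one more terminal. Two terminals at
  the new vertex reduce the claim to a tripod, whose leg at that vertex becomes the inner
  edge.\<close>

lemma grown_quartet:
  assumes G: "pair_graph G" and "grown G n S" "w \<in> S" "p \<in> S" "q \<in> S" "s \<in> S"
  shows "some_quartet G n w p q s"
  using assms(2-)
proof (induction arbitrary: w p q s)
  case (single r)
  then have "tripod G 0 r r r"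
    using grown_tripod[OF G grown.single] by blast
  then show ?case
    using single quartet_degenerate by (auto simp: some_quartet_def)
next
  case (step n S u v)
  have new: "grown G (Suc n) (insert v S)"
    using step by (blast intro: grown.step)
  then have "v \<in> pverts G"
    using grown_subset[OF G] by blast
  have dbl: "some_quartet G (Suc n) v v q s" if "q \<in> insert v S" "s \<in> insert v S" for q s
    using that grown_tripod[OF G new, of v q s] \<open>v \<in> pverts G\<close>
    unfolding some_quartet_def by (blast intro: quartet_degenerate)
  have leaf: "some_quartet G (Suc n) v p q s"
    if mem: "p \<in> insert v S" "q \<in> insert v S" "s \<in> insert v S" for p q s
  proof -
    consider "p = v" | "q = v" | "s = v" | "p \<in> S" "q \<in> S" "s \<in> S"
      using mem by blast
    then show ?thesis
    proof cases
      case 1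
      then show ?thesis using dbl mem by simp
    next
      case 2
      then show ?thesis using dbl[OF mem(3,1)] some_quartet_rotate by metis
    next
      case 3
      then show ?thesis using dbl[OF mem(1,2)] some_quartet_rotate by metis
    next
      case 4
      then have "some_quartet G n u p q s"
        using step by blast
      then show ?thesis
        unfolding some_quartet_def using step.hyps(3) by (blast intro: quartet_edge[OF G])
    qed
  qed
  consider "w = v" | "p = v" | "q = v" | "s = v" | "w \<in> S" "p \<in> S" "q \<in> S" "s \<in> S"
    using step.prems by blast
  then show ?case
  proof cases
    case 1
    then show ?thesis using leaf step.prems by simp
  next
    case 2
    then show ?thesis
      using leaf[OF step.prems(1,3,4)] some_quartet_swap by metis
  next
    case 3
    then show ?thesis
      using leaf[OF step.prems(1,4,2)] some_quartet_swap some_quartet_rotate by metis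
  next
    case 4
    then show ?thesis
      using leaf[OF step.prems(1,2,3)] some_quartet_swap some_quartet_rotate by metis
  next
    case 5
    then show ?thesis
      using some_quartet_mono[OF step.IH, of w p q s "Suc n"] by simp
  qed
qed

lemma spans_quartet:
  assumes "pair_graph G" "spans G n {w, p, q, s}"
  shows "some_quartet G n w p q s"
proof -
  obtain m T where m: "m \<le> n" "{w, p, q, s} \<subseteq> T" "grown G m T"
    using assms(2) by (auto simp: spans_def)
  then have "some_quartet G m w p q s"
    using grown_quartet[OF assms(1) m(3)] by simp
  then show ?thesis
    using m(1) by (rule some_quartet_mono)
qed

text \<open>Each bound adds up the segments that join the listed terminals inside the quartet. These
  are the pieces from which the recombined trees are assembled.\<close>

lemma quartet_subtrees:
  assumes "pair_graph G" "quartet G n w p q s"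
  obtains a b c d e where "a + b + c + d + e \<le> n"
    "spans G (a + b) {w, p}" "spans G (d + e) {q, s}" "spans G (a + c + e) {w, s}"
    "spans G (b + c + d + e) {p, q, s}" "spans G (a + c + d + e) {w, q, s}"
    "spans G (a + b + c + d) {w, p, q}"
proof -
  obtain x y a b c d e where *: "spans G a {w, x}" "spans G b {p, x}" "spans G c {x, y}"
    "spans G d {q, y}" "spans G e {s, y}" "a + b + c + d + e \<le> n"
    using assms(2) by (rule quartetE)
  note Un = spans_Un[OF assms(1)]
  have wp: "spans G (a + b) ({w, x} \<union> {p, x})" by (rule Un[OF *(1,2)]) simp
  have qs: "spans G (d + e) ({q, y} \<union> {s, y})" by (rule Un[OF *(4,5)]) simp
  have wy: "spans G (a + c) ({w, x} \<union> {x, y})" by (rule Un[OF *(1,3)]) simp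
  have py: "spans G (b + c) ({p, x} \<union> {x, y})" by (rule Un[OF *(2,3)]) simp
  have wpy: "spans G (a + b + c) ({w, x} \<union> {p, x} \<union> {x, y})" by (rule Un[OF wp *(3)]) simp
  show thesis
  proof (rule that)
    show "spans G (a + b) {w, p}"
      by (rule spans_mono[OF wp]) auto
    show "spans G (d + e) {q, s}"
      by (rule spans_mono[OF qs]) auto
    show "spans G (a + c + e) {w, s}"
      by (rule spans_mono[OF Un[OF wy *(5)]]) auto
    show "spans G (b + c + d + e) {p, q, s}"
      by (rule spans_mono[OF Un[OF py qs]]) auto
    show "spans G (a + c + d + e) {w, q, s}"
      by (rule spans_mono[OF Un[OF wy qs]]) auto
    show "spans G (a + b + c + d) {w, p, q}"
      by (rule spans_mono[OF Un[OF wpy *(4)]]) auto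
  qed (fact *(6))
qed

section \<open>Recombining trees\<close>

(* The vertex missing from a tree is its index in the proof idea: here p(i) = j and p(k) = l. *)
lemma recombine_disjoint_partners:
  assumes G: "pair_graph G"
    and i: "quartet G r w j k l" and k: "quartet G r w l i j"
    and jl: "spans G r {w, i, k, l}" "spans G r {w, i, j, k}"
    and min: "\<And>n. spans G n {i, j, k, l} \<Longrightarrow> t \<le> n"
  shows "7 * t \<le> 10 * r"
proof -
  obtain a b c d e where i: "a + b + c + d + e \<le> r"
    "spans G (a + b) {w, j}" "spans G (d + e) {k, l}"
    "spans G (b + c + d + e) {j, k, l}" "spans G (a + c + d + e) {w, k, l}"
    using quartet_subtrees[OF G i] by metis
  obtain a' b' c' d' e' where k: "a' + b' + c' + d' + e' \<le> r"
    "spans G (a' + b') {w, l}" "spans G (d' + e') {i, j}"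
    "spans G (b' + c' + d' + e') {l, i, j}" "spans G (a' + c' + d' + e') {w, i, j}"
    using quartet_subtrees[OF G k] by metis
  \<comment> \<open>Two trees that meet and jointly cover the four-set form a competitor for
    \<open>t\<close>.\<close>
  have min: "t \<le> m + n" if "spans G m S" "spans G n T" "S \<inter> T \<noteq> {}" "{i, j, k, l} \<subseteq> S \<union> T" for m n S T
    using spans_mono[OF spans_Un[OF G that(1-3)] that(4)] by (auto intro: min)
  \<comment> \<open>The tree of size \<open>r\<close> that misses \<open>j\<close> reaches it
    through the path from \<open>w\<close> to its partner \<open>j\<close>.\<close>
  have "t \<le> r + (a + b)" using jl(1) i(2) by (rule min) auto
  moreover have "t \<le> r + (a' + b')" using jl(2) k(2) by (rule min) auto
  moreover have "t \<le> (a + c + d + e) + (a' + c' + d' + e')" using i(5) k(5) by (rule min) auto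
  moreover have "t \<le> (b + c + d + e) + (d' + e')" using i(4) k(3) by (rule min) auto
  moreover have "t \<le> (d + e) + (b' + c' + d' + e')" using i(3) k(4) by (rule min) auto
  \<comment> \<open>Multipliers 2, 2, 1, 1, 1 for the five bounds give \<open>7 * t\<close> on the
    left. On the right \<open>r\<close> occurs 4 times and each segment at most 3 times, and the
    segments of either tree sum to at most \<open>r\<close>.\<close>
  ultimately show ?thesis
    using i(1) k(1) by linarith
qed

text \<open>The quartets come from the trees missing \<open>i\<close> and \<open>k\<close>, and both
  pair \<open>w\<close> with \<open>m\<close>. The roles of \<open>i\<close> and \<open>k\<close>
  are not symmetric here: only the second quartet supplies a path from \<open>w\<close> to
  \<open>l\<close>.\<close>

lemma recombine_common_partner:
  assumes G: "pair_graph G"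
    and i: "quartet G r w m k l" and k: "quartet G r w m i l"
    and ml: "spans G r {w, i, k, l}" "spans G r {w, i, k, m}"
    and min: "\<And>n. spans G n {i, k, l, m} \<Longrightarrow> t \<le> n"
  shows "7 * t \<le> 10 * r"
proof -
  obtain a b c d e where i: "a + b + c + d + e \<le> r"
    "spans G (a + b) {w, m}" "spans G (d + e) {k, l}"
    "spans G (b + c + d + e) {m, k, l}" "spans G (a + c + d + e) {w, k, l}"
    using quartet_subtrees[OF G i] by metis
  obtain a' b' c' d' e' where k: "a' + b' + c' + d' + e' \<le> r"
    "spans G (a' + b') {w, m}" "spans G (d' + e') {i, l}" "spans G (a' + c' + e') {w, l}"
    "spans G (b' + c' + d' + e') {m, i, l}" "spans G (a' + b' + c' + d') {w, m, i}"
    using quartet_subtrees[OF G k] by metis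
  have min: "t \<le> m' + n" if "spans G m' S" "spans G n T" "S \<inter> T \<noteq> {}" "{i, k, l, m} \<subseteq> S \<union> T" for m' n S T
    using spans_mono[OF spans_Un[OF G that(1-3)] that(4)] by (auto intro: min)
  have "t \<le> r + (a + b)" using ml(1) i(2) by (rule min) auto
  moreover have "t \<le> r + (a' + b')" using ml(1) k(2) by (rule min) auto
  moreover have "t \<le> r + (a' + c' + e')" using ml(2) k(4) by (rule min) auto
  moreover have "t \<le> (a + c + d + e) + (a' + b' + c' + d')" using i(5) k(6) by (rule min) auto
  moreover have "t \<le> (b + c + d + e) + (d' + e')" using i(4) k(3) by (rule min) auto
  moreover have "t \<le> (d + e) + (b' + c' + d' + e')" using i(3) k(5) by (rule min) auto
  \<comment> \<open>Multiplier 2 for the first bound and 1 for the other five again give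
    \<open>7 * t\<close> against 4 times \<open>r\<close> and at most 3 times each segment.\<close>
  ultimately show ?thesis
    using i(1) k(1) by linarith
qed

text \<open>With \<open>j\<close> the partner of \<open>w\<close> in the tree missing
  \<open>i\<close>, the trees missing \<open>k\<close> and \<open>l\<close> are inspected. Either
  one of them combines with the tree missing \<open>i\<close>, or both pair \<open>w\<close> with
  \<open>i\<close> and combine with each other.\<close>

lemma recombine_given_partner:
  assumes G: "pair_graph G" and i: "quartet G r w j k l"
    and sp: "spans G r {w, i, j, k}" "spans G r {w, i, j, l}" "spans G r {w, i, k, l}"
      "spans G r {w, j, k, l}"
    and min: "\<And>n. spans G n {i, j, k, l} \<Longrightarrow> t \<le> n"
  shows "7 * t \<le> 10 * r"
proof -
  have k: "quartet G r w i j l \<or> quartet G r w j i l \<or> quartet G r w l i j"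
    and l: "quartet G r w i j k \<or> quartet G r w j i k \<or> quartet G r w k i j"
    using spans_quartet[OF G] sp(1,2) by (auto simp: some_quartet_def)
  note disjoint = recombine_disjoint_partners[OF G] and common = recombine_common_partner[OF G]
  consider "quartet G r w j i l" | "quartet G r w l i j" | "quartet G r w j i k"
    | "quartet G r w k i j" | "quartet G r w i j l" "quartet G r w i j k"
    using k l by blast
  then show ?thesis
  proof cases
    case 1
    show ?thesis
      by (rule common[OF i 1]) (use sp min in \<open>auto simp: insert_commute\<close>)
  next
    case 2
    show ?thesis
      by (rule disjoint[OF i 2]) (use sp min in \<open>auto simp: insert_commute\<close>)
  next
    case 3
    show ?thesis
      by (rule common[OF quartet_swap[OF i] 3]) (use sp min in \<open>auto simp: insert_commute\<close>)
  next
    case 4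
    show ?thesis
      by (rule disjoint[OF quartet_swap[OF i] 4]) (use sp min in \<open>auto simp: insert_commute\<close>)
  next
    case 5
    show ?thesis
      \<comment> \<open>Now \<open>i\<close> is the common partner, and the missing vertices are
        \<open>k\<close> and \<open>l\<close>.\<close>
      by (rule common[OF quartet_swap[OF 5(1)] quartet_swap[OF 5(2)]])
        (use sp min in \<open>auto simp: insert_commute\<close>)
  qed
qed

text \<open>The three possible partners of \<open>w\<close> in the tree missing \<open>i\<close>
  differ only by renaming \<open>j\<close>, \<open>k\<close>, \<open>l\<close>.\<close>

lemma recombine:
  assumes G: "pair_graph G"
    and sp: "spans G r {w, j, k, l}" "spans G r {w, i, k, l}" "spans G r {w, i, j, l}"
      "spans G r {w, i, j, k}"
    and min: "\<And>n. spans G n {i, j, k, l} \<Longrightarrow> t \<le> n"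
  shows "7 * t \<le> 10 * r"
proof -
  note given = recombine_given_partner[OF G]
  consider "quartet G r w j k l" | "quartet G r w k j l" | "quartet G r w l j k"
    using spans_quartet[OF G sp(1)] by (auto simp: some_quartet_def)
  then show ?thesis
  proof cases
    case 1
    show ?thesis
      by (rule given[OF 1, of i]) (use sp min in \<open>auto simp: insert_commute\<close>)
  next
    case 2
    show ?thesis
      by (rule given[OF 2, of i]) (use sp min in \<open>auto simp: insert_commute\<close>)
  next
    case 3
    show ?thesis
      by (rule given[OF 3, of i]) (use sp min in \<open>auto simp: insert_commute\<close>)
  qed
qed

section \<open>Extremal four-set and central vertex\<close>

lemma finite_steiner_distances:
  assumes "pair_graph G"
  shows "finite {steiner_distance G S | S. S \<subseteq> pverts G \<and> card S = k \<and> v \<in> S}"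
proof -
  interpret pair_graph G by fact
  have "{steiner_distance G S | S. S \<subseteq> pverts G \<and> card S = k \<and> v \<in> S}
      \<subseteq> steiner_distance G ` Pow (pverts G)"
    by auto
  then show ?thesis
    using pair_finite_verts by (meson finite_Pow_iff finite_imageI finite_subset)
qed

theorem mainTheorem3:
  fixes G :: "'a pair_pre_digraph"
  assumes "pair_graph G"
    and "Digraph_Component.connected (with_proj G)"
    and "card (pverts G) \<ge> 4"
  shows "real (sdiam 4 G) \<le> 10 / 7 * real (srad 4 G)"
proof -
  interpret pair_graph G by fact
  have ecc: "finite {steiner_ecc 4 G v | v. v \<in> pverts G}"
    "{steiner_ecc 4 G v | v. v \<in> pverts G} \<noteq> {}"
    using pair_finite_verts assms(3) by auto
  obtain w where w: "w \<in> pverts G" "srad 4 G = steiner_ecc 4 G w"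
    using Min_in[OF ecc] unfolding srad_def by blast
  obtain v where v: "v \<in> pverts G" "sdiam 4 G = steiner_ecc 4 G v"
    using Max_in[OF ecc] unfolding sdiam_def by blast
  \<comment> \<open>Some four-set contains \<open>v\<close>, so the maximum defining its
    eccentricity is over a non-empty set and is attained.\<close>
  have "3 \<le> card (pverts G - {v})"
    using assms(3) v(1) by simp
  then obtain B where B: "B \<subseteq> pverts G - {v}" "card B = 3"
    by (rule obtain_subset_with_card_n)
  then have "finite B" "v \<notin> B"
    using pair_finite_verts finite_subset by blast+
  then have "insert v B \<subseteq> pverts G \<and> card (insert v B) = 4 \<and> v \<in> insert v B"
    using B v by auto
  then have "{steiner_distance G S | S. S \<subseteq> pverts G \<and> card S = 4 \<and> v \<in> S} \<noteq> {}"
    by blast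
  then have "steiner_ecc 4 G v \<in> {steiner_distance G S | S. S \<subseteq> pverts G \<and> card S = 4 \<and> v \<in> S}"
    unfolding steiner_ecc_def by (rule Max_in[OF finite_steiner_distances[OF assms(1)]])
  then obtain D where D: "D \<subseteq> pverts G" "card D = 4" "sdiam 4 G = steiner_distance G D"
    unfolding v(2) by blast
  have le: "steiner_distance G S \<le> srad 4 G" if "S \<subseteq> pverts G" "card S = 4" "w \<in> S" for S
    unfolding w(2) steiner_ecc_def
    by (rule Max_ge[OF finite_steiner_distances[OF assms(1)]]) (use that in blast)
  have "7 * sdiam 4 G \<le> 10 * srad 4 G"
  \<comment> \<open>If \<open>w\<close> lies in \<open>D\<close>, then \<open>D\<close> itself is
    among the sets defining the eccentricity of \<open>w\<close>. Otherwise \<open>w\<close> and any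
    three vertices of \<open>D\<close> form a genuine four-set, as the eccentricity bound
    requires.\<close>
  proof (cases "w \<in> D")
    case True
    then show ?thesis using le[of D] D by simp
  next
    case False
    obtain i j k l where ijkl: "D = {i, j, k, l}" "distinct [i, j, k, l]"
      using D(2) by (auto simp: card_Suc_eq numeral_eq_Suc)
    have sp: "spans G (srad 4 G) {w, x, y, z}" if "{x, y, z} \<subseteq> D" "distinct [x, y, z]" for x y z
    proof -
      have sub: "{w, x, y, z} \<subseteq> pverts G"
        using that D(1) w(1) by auto
      have "distinct [w, x, y, z]"
        using that False by auto
      from distinct_card[OF this] have "steiner_distance G {w, x, y, z} \<le> srad 4 G"
        using sub by (intro le) auto
      with spans_steiner_distance[OF assms(1,2) sub] show ?thesis
        by (rule spans_mono[OF _ subset_refl])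
    qed
    show ?thesis
      by (rule recombine[OF assms(1), of _ w j k l i])
        (use sp ijkl D(3) steiner_distance_le[OF assms(1)] in auto)
  qed
  then show ?thesis by simp
qed

end
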